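(* Let $K$ be a field of characteristic $0$, let $n\ge1$, let $\mathbf{q}=(q_1,\dots,q_n)$ be formal variables subject only to $q_1\cdots q_n=1$, and let \[ \mathbf{e}_n(\mathbf{q})=\sum_{\sigma\in S_n}\frac{\prod_{j\in D(\sigma)} q_{\sigma(1)}\cdots q_{\sigma(j)}}{\prod_{i=1}^{n-1}\bigl(1-q_{\sigma(1)}\cdots q_{\sigma(i)}\bigr)}\,\sigma\in K(\mathbf{q})S_n . \] Then $\mathbf{e}_n(\mathbf{q})\ltimes\mathbf{e}_n(\mathbf{q})=\mathbf{e}_n(\mathbf{q})$, i.e. $\mathbf{e}_n(\mathbf{q})$ is idempotent in $K(\mathbf{q})S_n$ with the twisted product.
   Context: $K(\mathbf{q})$ is the field of rational functions over $K$ in $q_1,\dots,q_{n-1}$, with $q_n:=(q_1\cdots q_{n-1})^{-1}$. For $\sigma\in S_n$, $D(\sigma)=\{i:1\le i\le n-1,\ \sigma(i)>\sigma(i+1)\}$. $K(\mathbf{q})S_n$ is the $K(\mathbf{q})$-vector space with basis $S_n$. $S_n$ acts on $K(\mathbf{q})$ by $\sigma\cdot f(q_1,\dots,q_n)=f(q_{\sigma(1)},\dots,q_{\sigma(n)})$ (this preserves the relation $q_1\cdots q_n=1$). The twisted product on $K(\mathbf{q})S_n$ is defined by $f\sigma\ltimes g\tau=(f\cdot(\sigma\cdot g))\,\sigma\tau$ for $f,g\in K(\mathbf{q})$, $\sigma,\tau\in S_n$, where $\sigma\tau$ is composition (apply $\tau$ first), extended bilinearly. *)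

theory Defs
  imports
    "HOL-Library.Poly_Mapping"
    "HOL-Computational_Algebra.Fraction_Field"
    "HOL-Combinatorics.Permutations"
begin

text \<open>
  Polynomials over \<open>'k\<close> in variables indexed by \<open>nat\<close> are finitely supported maps from
  exponent vectors to coefficients. Since the number \<open>n\<close> is a term and not a type, the
  field \<open>K(q)\<close> in the variables \<open>q_1, ..., q_{n-1}\<close> is carved out as a subset of the
  fraction field in infinitely many variables.
\<close>

type_synonym 'k mpoly = "(nat \<Rightarrow>\<^sub>0 nat) \<Rightarrow>\<^sub>0 'k"

type_synonym 'k ratfun = "'k mpoly fract"

definition poly_vars :: "'k::zero mpoly \<Rightarrow> nat set" where
  "poly_vars P = (\<Union>m\<in>Poly_Mapping.keys P. Poly_Mapping.keys m)"

definition Kq_polys :: "nat \<Rightarrow> 'k::zero mpoly set" where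
  "Kq_polys n = {P. poly_vars P \<subseteq> {1..<n}}"

definition Kq :: "nat \<Rightarrow> 'k::field ratfun set" where
  "Kq n = {Fract P Q | P Q. P \<in> Kq_polys n \<and> Q \<in> Kq_polys n \<and> Q \<noteq> 0}"

definition const_ratfun :: "'k::field \<Rightarrow> 'k ratfun" where
  "const_ratfun c = Fract (Poly_Mapping.single 0 c) 1"

definition var_ratfun :: "nat \<Rightarrow> 'k::field ratfun" where
  "var_ratfun i = Fract (Poly_Mapping.single (Poly_Mapping.single i 1) 1) 1"

definition qvar :: "nat \<Rightarrow> nat \<Rightarrow> 'k::field ratfun" where
  "qvar n i = (if i = n then inverse (\<Prod>j\<in>{1..<n}. var_ratfun j) else var_ratfun i)"

definition eval_mpoly :: "(nat \<Rightarrow> 'k ratfun) \<Rightarrow> 'k::field mpoly \<Rightarrow> 'k ratfun" where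
  "eval_mpoly x P = (\<Sum>m\<in>Poly_Mapping.keys P.
     const_ratfun (Poly_Mapping.lookup P m) *
     (\<Prod>i\<in>Poly_Mapping.keys m. x i ^ Poly_Mapping.lookup m i))"

text \<open>
  The action \<open>\<sigma> \<cdot> f(q_1, ..., q_n) = f(q_{\<sigma>(1)}, ..., q_{\<sigma>(n)})\<close>: substitute
  \<open>q_{\<sigma>(i)}\<close> for \<open>q_i\<close> in numerator and denominator. For \<open>f \<in> Kq n\<close> and \<open>\<sigma>\<close> a permutation of
  \<open>{1..n}\<close> the value does not depend on the representation of \<open>f\<close> as a fraction, and the new
  denominator is nonzero, because \<open>q_{\<sigma>(1)}, ..., q_{\<sigma>(n-1)}\<close> are algebraically independent.
  No meaning is intended for other \<open>f\<close> or \<open>\<sigma>\<close>.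
\<close>

definition perm_act :: "nat \<Rightarrow> (nat \<Rightarrow> nat) \<Rightarrow> 'k::field ratfun \<Rightarrow> 'k ratfun" where
  "perm_act n \<sigma> f = (THE h. \<forall>P\<in>Kq_polys n. \<forall>Q\<in>Kq_polys n. Q \<noteq> 0 \<longrightarrow> f = Fract P Q \<longrightarrow>
     h = eval_mpoly (\<lambda>i. qvar n (\<sigma> i)) P / eval_mpoly (\<lambda>i. qvar n (\<sigma> i)) Q)"

text \<open>
  Elements of the free vector space on \<open>S_n\<close> are finitely supported maps \<open>\<sigma> \<mapsto> coefficient of \<sigma>\<close>;
  \<^term>\<open>Poly_Mapping.single \<sigma> f\<close> is \<open>f \<sigma>\<close>.
\<close>

definition KqS :: "nat \<Rightarrow> ((nat \<Rightarrow> nat) \<Rightarrow>\<^sub>0 'k::field ratfun) set" where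
  "KqS n = {a. (\<forall>\<sigma>\<in>Poly_Mapping.keys a. \<sigma> permutes {1..n}) \<and>
               (\<forall>\<sigma>. Poly_Mapping.lookup a \<sigma> \<in> Kq n)}"

definition twisted_prod ::
  "nat \<Rightarrow> ((nat \<Rightarrow> nat) \<Rightarrow>\<^sub>0 'k::field ratfun) \<Rightarrow> ((nat \<Rightarrow> nat) \<Rightarrow>\<^sub>0 'k ratfun)
    \<Rightarrow> ((nat \<Rightarrow> nat) \<Rightarrow>\<^sub>0 'k ratfun)" where
  "twisted_prod n a b = (\<Sum>\<sigma>\<in>Poly_Mapping.keys a. \<Sum>\<tau>\<in>Poly_Mapping.keys b.
     Poly_Mapping.single (\<sigma> \<circ> \<tau>)
       (Poly_Mapping.lookup a \<sigma> * perm_act n \<sigma> (Poly_Mapping.lookup b \<tau>)))"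

definition descents :: "nat \<Rightarrow> (nat \<Rightarrow> nat) \<Rightarrow> nat set" where
  "descents n \<sigma> = {i. 1 \<le> i \<and> i \<le> n - 1 \<and> \<sigma> i > \<sigma> (i + 1)}"

definition e_elem :: "nat \<Rightarrow> ((nat \<Rightarrow> nat) \<Rightarrow>\<^sub>0 'k::field ratfun)" where
  "e_elem n = (\<Sum>\<sigma>\<in>{\<sigma>. \<sigma> permutes {1..n}}. Poly_Mapping.single \<sigma>
     ((\<Prod>j\<in>descents n \<sigma>. \<Prod>i=1..j. qvar n (\<sigma> i)) /
      (\<Prod>i=1..n-1. 1 - (\<Prod>j=1..i. qvar n (\<sigma> j)))))"

end

theory Submission
  imports "HOL-Combinatorics.Multiset_Permutations" Defs
begin

text \<open>
  Write \<open>f_\<sigma>\<close> for the coefficient of \<open>\<sigma>\<close>, and for a permutation \<open>\<pi>\<close> put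
  \<open>y_j = q_{\<pi>(1)} \<cdots> q_{\<pi>(j)}\<close>. Since \<open>\<sigma> \<cdot> f_{\<sigma>\<inverse>\<pi>}\<close> has the denominator
  \<open>\<Prod>_j (1 - y_j)\<close> for every \<open>\<sigma>\<close>, idempotency says that
  \<open>\<Sum>_\<sigma> f_\<sigma> \<Prod>_{j \<in> D(\<sigma>\<inverse>\<pi>)} y_j = f_\<pi> \<Prod>_j (1 - y_j)\<close>. This holds for arbitrary \<open>y_j\<close>,
  because the sum \<open>N(T)\<close> of all \<open>f_\<sigma>\<close> with \<open>D(\<sigma>\<inverse>\<pi>) = T\<close> equals \<open>(-1)^|T| f_\<pi>\<close>: clearly
  \<open>N(\<emptyset>) = f_\<pi>\<close>, and \<open>N(T) + N(T \<union> {j})\<close> is a sum over complete shuffle classes of the two sets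
  \<open>\<pi>{1..j}\<close> and \<open>\<pi>{j+1..n}\<close>. Without the relation \<open>q_1 \<cdots> q_n = 1\<close> the weights that also have the
  factor \<open>1 - q_1 \<cdots> q_n\<close> in the denominator are multiplicative on shuffles, so with the relation
  the sum of \<open>f\<close> over every such class is zero.
\<close>

section \<open>Weights of words and shuffles\<close>

text \<open>
  Words are read from the right: the head of a list is the last letter of the word, and \<open>c\<close> is a
  virtual letter following it, so the factor \<open>if c < a\<close> records a descent at the end of the word.
\<close>

fun word_weight :: "('a::linorder \<Rightarrow> 'f::field) \<Rightarrow> 'a \<Rightarrow> 'a list \<Rightarrow> 'f" where
  "word_weight q c [] = 1"
| "word_weight q c (a # w) =
     (if c < a then prod_list (map q (a # w)) else 1) / (1 - prod_list (map q (a # w))) * word_weight q a w"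

text \<open>
  The factor of the full product, which vanishes when all letters multiply to 1, is left out of the
  denominator.
\<close>

fun cyclic_weight :: "('a::linorder \<Rightarrow> 'f::field) \<Rightarrow> 'a list \<Rightarrow> 'f" where
  "cyclic_weight q [] = 1"
| "cyclic_weight q (a # w) = word_weight q a w"

lemma sum_shuffles_Cons:
  assumes "x \<noteq> y"
  shows "(\<Sum>w\<in>shuffles (x # xs) (y # ys). f w) =
    (\<Sum>w\<in>shuffles xs (y # ys). f (x # w)) + (\<Sum>w\<in>shuffles (x # xs) ys. f (y # w))"
proof -
  have "(\<Sum>w\<in>shuffles (x # xs) (y # ys). f w) =
    (\<Sum>w\<in>(#) x ` shuffles xs (y # ys). f w) + (\<Sum>w\<in>(#) y ` shuffles (x # xs) ys. f w)"
    unfolding shuffles.simps by (rule sum.union_disjoint) (use assms in auto)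
  also have "\<dots> = (\<Sum>w\<in>shuffles xs (y # ys). f (x # w)) + (\<Sum>w\<in>shuffles (x # xs) ys. f (y # w))"
    by (simp add: sum.reindex)
  finally show ?thesis .
qed

lemma prod_list_shuffles:
  fixes q :: "'a \<Rightarrow> 'f::comm_monoid_mult"
  assumes "w \<in> shuffles u v"
  shows "prod_list (map q w) = prod_list (map q u) * prod_list (map q v)"
  using assms by (induction u v arbitrary: w rule: shuffles.induct) (auto simp: mult_ac)

lemma prod_list_map_distinct:
  "distinct xs \<Longrightarrow> prod_list (map q xs) = (\<Prod>x\<in>set xs. q x :: 'f::comm_monoid_mult)"
  by (simp add: prod.distinct_set_conv_list)

text \<open>The induction step for \<open>sum_word_weight_shuffles\<close> with common factors
  removed: \<open>U\<close> and \<open>V\<close> stand for the letter products of the two words,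
  \<open>a\<close> and \<open>b\<close> for their last letters, and each summand on the left belongs
  to one choice of the letter that ends the shuffle. For each order of \<open>a\<close>,
  \<open>b\<close>, \<open>c\<close>, clearing denominators leaves a polynomial identity.\<close>

lemma two_block_identity:
  fixes U V :: "'f::field" and a b c :: "'a::linorder"
  assumes "U \<noteq> 1" "V \<noteq> 1" "U * V \<noteq> 1" "a \<noteq> b"
  shows "(if c < a then U * V else 1) / (1 - U * V) * ((if a < b then V else 1) / (1 - V)) +
         (if c < b then U * V else 1) / (1 - U * V) * ((if b < a then U else 1) / (1 - U)) =
         (if c < a then U else 1) / (1 - U) * ((if c < b then V else 1) / (1 - V))"
proof -
  have nz: "1 - U \<noteq> 0" "1 - V \<noteq> 0" "1 - U * V \<noteq> 0" using assms by auto
  show ?thesis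
    using nz \<open>a \<noteq> b\<close> by (cases a b rule: linorder_cases) (auto simp: divide_simps, auto simp: algebra_simps)
qed

text \<open>A shuffle ends with the last letter of \<open>u\<close> or of \<open>v\<close>. That
  letter becomes the virtual letter for the rest, so the induction runs over all \<open>c\<close>.
  The hypothesis on \<open>prod q A\<close> keeps the denominators nonzero.\<close>

lemma sum_word_weight_shuffles:
  assumes "distinct (u @ v)"
    and "\<And>A. A \<noteq> {} \<Longrightarrow> A \<subseteq> set (u @ v) \<Longrightarrow> prod q A \<noteq> 1"
  shows "(\<Sum>w\<in>shuffles u v. word_weight q c w) = word_weight q c u * word_weight q c v"
  using assms
proof (induction u v arbitrary: c rule: shuffles.induct)
  case (3 a u b v)
  define U where "U = prod_list (map q (a # u))"
  define V where "V = prod_list (map q (b # v))"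
  have ab: "a \<noteq> b" and dist: "distinct (a # u)" "distinct (b # v)" "distinct ((a # u) @ (b # v))"
    using "3.prems"(1) by auto
  have "U \<noteq> 1" "V \<noteq> 1" "U * V \<noteq> 1"
  proof -
    have "U = prod q (set (a # u))" "V = prod q (set (b # v))"
      using dist by (simp_all only: U_def V_def prod_list_map_distinct)
    moreover have "U * V = prod_list (map q ((a # u) @ (b # v)))"
      by (simp add: U_def V_def)
    then have "U * V = prod q (set ((a # u) @ (b # v)))"
      using dist by (simp only: prod_list_map_distinct)
    ultimately show "U \<noteq> 1" "V \<noteq> 1" "U * V \<noteq> 1"
      using "3.prems"(2)[of "set (a # u)"] "3.prems"(2)[of "set (b # v)"]
        "3.prems"(2)[of "set ((a # u) @ (b # v))"] by (auto simp: subset_insertI2)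
  qed
  have UV: "prod_list (map q (a # w)) = U * V" if "w \<in> shuffles u (b # v)" for w
    using prod_list_shuffles[OF that, of q] by (simp add: U_def V_def mult_ac)
  have UV': "prod_list (map q (b # w)) = U * V" if "w \<in> shuffles (a # u) v" for w
    using prod_list_shuffles[OF that, of q] by (simp add: U_def V_def mult_ac)
  have IH1: "(\<Sum>w\<in>shuffles u (b # v). word_weight q a w) = word_weight q a u * word_weight q a (b # v)"
    by (rule "3.IH"(1)) (use "3.prems" in auto)
  have IH2: "(\<Sum>w\<in>shuffles (a # u) v. word_weight q b w) = word_weight q b (a # u) * word_weight q b v"
    by (rule "3.IH"(2)) (use "3.prems" in auto)
  have "(\<Sum>w\<in>shuffles (a # u) (b # v). word_weight q c w) =
     (if c < a then U * V else 1) / (1 - U * V) * (\<Sum>w\<in>shuffles u (b # v). word_weight q a w) +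
     (if c < b then U * V else 1) / (1 - U * V) * (\<Sum>w\<in>shuffles (a # u) v. word_weight q b w)"
    unfolding sum_shuffles_Cons[OF ab] word_weight.simps sum_distrib_left
    by (intro arg_cong2[of _ _ _ _ "(+)"] sum.cong refl) (simp_all only: UV UV')
  also have "\<dots> = ((if c < a then U * V else 1) / (1 - U * V) * ((if a < b then V else 1) / (1 - V)) +
         (if c < b then U * V else 1) / (1 - U * V) * ((if b < a then U else 1) / (1 - U))) *
       (word_weight q a u * word_weight q b v)"
    unfolding IH1 IH2 word_weight.simps U_def[symmetric] V_def[symmetric]
    by (simp add: algebra_simps)
  also have "\<dots> = word_weight q c (a # u) * word_weight q c (b # v)"
    unfolding two_block_identity[OF \<open>U \<noteq> 1\<close> \<open>V \<noteq> 1\<close> \<open>U * V \<noteq> 1\<close> ab] word_weight.simps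
      U_def[symmetric] V_def[symmetric]
    by (simp add: algebra_simps)
  finally show ?case .
qed auto

text \<open>The last letter of a shuffle contributes no factor of its own, and removing it leaves a
  proper subset of the letters, where \<open>sum_word_weight_shuffles\<close> applies. The two
  resulting products agree up to one factor each, and these two factors sum to zero because the
  letters multiply to 1.\<close>

lemma sum_cyclic_weight_shuffles:
  assumes "distinct (u @ v)" and "u \<noteq> []" "v \<noteq> []"
    and one: "prod q (set (u @ v)) = 1"
    and "\<And>A. A \<noteq> {} \<Longrightarrow> A \<subset> set (u @ v) \<Longrightarrow> prod q A \<noteq> 1"
  shows "(\<Sum>w\<in>shuffles u v. cyclic_weight q w) = 0"
proof -
  obtain a u' b v' where u: "u = a # u'" and v: "v = b # v'"
    using assms by (meson neq_Nil_conv)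
  define U where "U = prod_list (map q u)"
  define V where "V = prod_list (map q v)"
  have ab: "a \<noteq> b" using assms(1) u v by auto
  have UV: "U * V = 1"
  proof -
    have "U * V = prod_list (map q (u @ v))" by (simp add: U_def V_def)
    also have "\<dots> = 1" using assms(1) one by (simp only: prod_list_map_distinct)
    finally show ?thesis .
  qed
  have V1: "V \<noteq> 1"
  proof -
    have "V = prod q (set v)" using assms(1) by (simp add: V_def prod_list_map_distinct)
    moreover have "set v \<subset> set (u @ v)" using assms(1) u by auto
    ultimately show ?thesis using assms(5) v by simp
  qed
  have U1: "U \<noteq> 1" using UV V1 by auto
  have S1: "(\<Sum>w\<in>shuffles u' v. word_weight q a w) = word_weight q a u' * word_weight q a v"
  proof (rule sum_word_weight_shuffles)
    fix A assume "A \<noteq> {}" "A \<subseteq> set (u' @ v)"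
    moreover have "set (u' @ v) \<subset> set (u @ v)" using assms(1) u by auto
    ultimately show "prod q A \<noteq> 1" using assms(5) by blast
  qed (use assms(1) u in auto)
  have S2: "(\<Sum>w\<in>shuffles u v'. word_weight q b w) = word_weight q b u * word_weight q b v'"
  proof (rule sum_word_weight_shuffles)
    fix A assume "A \<noteq> {}" "A \<subseteq> set (u @ v')"
    moreover have "set (u @ v') \<subset> set (u @ v)" using assms(1) v by auto
    ultimately show "prod q A \<noteq> 1" using assms(5) by blast
  qed (use assms(1) v in auto)
  have "(\<Sum>w\<in>shuffles u v. cyclic_weight q w) =
      word_weight q a u' * word_weight q a v + word_weight q b u * word_weight q b v'"
    using S1 S2 unfolding u v sum_shuffles_Cons[OF ab] by simp
  also have "\<dots> = ((if a < b then V else 1) / (1 - V) + (if b < a then U else 1) / (1 - U)) *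
      (word_weight q a u' * word_weight q b v')"
    unfolding u v word_weight.simps U_def[unfolded u, symmetric] V_def[unfolded v, symmetric]
    by (simp add: algebra_simps)
  \<comment> \<open>\<open>U * V = 1\<close> gives \<open>1 / (1 - U) = - V / (1 - V)\<close>, and
    likewise with \<open>U\<close> and \<open>V\<close> exchanged.\<close>
  also have "(if a < b then V else 1) / (1 - V) + (if b < a then U else 1) / (1 - U) = 0"
  proof -
    have nz: "1 - U \<noteq> 0" "1 - V \<noteq> 0" using U1 V1 by auto
    show ?thesis
      using ab nz UV
      by (cases a b rule: linorder_cases) (auto simp: order.asym divide_simps, auto simp: algebra_simps)
  qed
  finally show ?thesis by simp
qed

section \<open>Descents and words of permutations\<close>

lemma descents_eq: "descents n \<sigma> = {i\<in>{1..<n}. \<sigma> (Suc i) < \<sigma> i}"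
  by (auto simp: descents_def)

text \<open>\<open>rev\<close> puts the letter in position \<open>n\<close> at the head, matching
  the convention that words are read from the right.\<close>

definition word_of :: "nat \<Rightarrow> (nat \<Rightarrow> nat) \<Rightarrow> nat list" where
  "word_of n \<sigma> = rev (map \<sigma> [1..<Suc n])"

lemma bij_betw_word_of:
  "bij_betw (word_of n) {\<sigma>. \<sigma> permutes {1..n}} (permutations_of_set {1..n})"
proof (rule bij_betw_imageI)
  show inj: "inj_on (word_of n) {\<sigma>. \<sigma> permutes {1..n}}"
  proof (rule inj_onI)
    fix \<sigma> \<tau> assume a: "\<sigma> \<in> {\<sigma>. \<sigma> permutes {1..n}}" "\<tau> \<in> {\<sigma>. \<sigma> permutes {1..n}}"
      "word_of n \<sigma> = word_of n \<tau>"
    from a(3) have "\<forall>i\<in>{1..n}. \<sigma> i = \<tau> i"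
      by (auto simp: word_of_def map_eq_conv simp del: upt_Suc)
    with a(1,2) show "\<sigma> = \<tau>"
      by (metis (no_types, lifting) ext mem_Collect_eq permutes_not_in)
  qed
  show "word_of n ` {\<sigma>. \<sigma> permutes {1..n}} = permutations_of_set {1..n}"
  \<comment> \<open>Surjectivity by counting: both sets have \<open>n!\<close> elements.\<close>
  proof (rule card_subset_eq)
    show "word_of n ` {\<sigma>. \<sigma> permutes {1..n}} \<subseteq> permutations_of_set {1..n}"
    proof (clarify, rule permutations_of_setI)
      fix \<sigma> assume \<sigma>: "\<sigma> permutes {1..n}"
      have "set (word_of n \<sigma>) = \<sigma> ` {1..n}"
        by (simp add: word_of_def atLeastLessThanSuc_atLeastAtMost del: upt_Suc)
      then show "set (word_of n \<sigma>) = {1..n}" using permutes_image[OF \<sigma>] by simp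
      show "distinct (word_of n \<sigma>)"
        using permutes_inj_on[OF \<sigma>] by (simp add: word_of_def distinct_map del: upt_Suc)
    qed
    show "card (word_of n ` {\<sigma>. \<sigma> permutes {1..n}}) = card (permutations_of_set {1..n})"
      unfolding card_image[OF inj] by (simp add: card_permutations[of "{1..n}" n, simplified])
  qed simp
qed

text \<open>\<open>inv \<sigma>\<close> gives the position of a letter, and the reversal in
  \<open>word_of\<close> lists the letter in the later position first.\<close>

lemma filter_word_of:
  assumes \<sigma>: "\<sigma> permutes {1..n}" and xy: "x \<in> {1..n}" "y \<in> {1..n}" "x \<noteq> y"
  shows "filter (\<lambda>z. z \<in> {x, y}) (word_of n \<sigma>) = (if inv \<sigma> x < inv \<sigma> y then [y, x] else [x, y])"
proof -
  define a b where "a = inv \<sigma> x" and "b = inv \<sigma> y"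
  have \<sigma>ab: "\<sigma> a = x" "\<sigma> b = y" using permutes_inverses[OF \<sigma>] by (auto simp: a_def b_def)
  have ab: "a \<in> {1..n}" "b \<in> {1..n}"
    using xy permutes_in_image[OF permutes_inv[OF \<sigma>]] unfolding a_def b_def by blast+
  have "a \<noteq> b" using xy(3) \<sigma>ab by metis
  have iff: "\<sigma> k \<in> {x, y} \<longleftrightarrow> k \<in> {a, b}" for k
    using \<sigma>ab permutes_inj[OF \<sigma>] by (auto dest: injD)
  have "filter (\<lambda>k. k \<in> {a, b}) [1..<Suc n] = (if a < b then [a, b] else [b, a])"
    by (rule sorted_distinct_set_unique) (use ab \<open>a \<noteq> b\<close> in \<open>auto simp: sorted_wrt_filter simp del: upt_Suc\<close>)
  then have "filter (\<lambda>k. \<sigma> k \<in> {x, y}) [1..<Suc n] = (if a < b then [a, b] else [b, a])"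
    by (simp only: iff)
  then show ?thesis
    by (auto simp: word_of_def filter_map rev_filter[symmetric] o_def \<sigma>ab a_def[symmetric] b_def[symmetric]
      simp del: upt_Suc)
qed

text \<open>The order of two letters is already decided by the subword on any set of letters
  containing both, so it is constant on shuffle classes when both lie in one block.\<close>

lemma filter_pair_cong:
  assumes "filter P w = filter P w'" "P x" "P y"
  shows "filter (\<lambda>z. z \<in> {x, y}) w = filter (\<lambda>z. z \<in> {x, y}) w'"
proof -
  have "filter (\<lambda>z. z \<in> {x, y}) w = filter (\<lambda>z. z \<in> {x, y}) (filter P w)" for w
    using assms(2,3) by (auto intro!: filter_cong simp: filter_filter)
  then show ?thesis using assms(1) by metis
qed

text \<open>Captures the descents of \<open>inv \<sigma> \<circ> \<pi>\<close> by two-letter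
  subwords of the word of \<sigma> instead of positions, so that their behaviour under shuffles can
  be read off.\<close>

definition inverted_pairs :: "nat \<Rightarrow> (nat \<Rightarrow> nat) \<Rightarrow> nat list \<Rightarrow> nat set" where
  "inverted_pairs n \<pi> w = {j\<in>{1..<n}. filter (\<lambda>z. z \<in> {\<pi> j, \<pi> (Suc j)}) w = [\<pi> j, \<pi> (Suc j)]}"

text \<open>A descent of \<open>inv \<sigma> \<circ> \<pi>\<close> at \<open>j\<close> means that
  \<open>\<pi> (Suc j)\<close> has an earlier position in \<sigma> than \<open>\<pi> j\<close>; in
  the reversed word \<open>\<pi> j\<close> then comes first.\<close>

lemma inverted_pairs_word_of:
  assumes \<sigma>: "\<sigma> permutes {1..n}" and \<pi>: "\<pi> permutes {1..n}"
  shows "inverted_pairs n \<pi> (word_of n \<sigma>) = descents n (inv \<sigma> \<circ> \<pi>)"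
proof -
  have "filter (\<lambda>z. z \<in> {\<pi> j, \<pi> (Suc j)}) (word_of n \<sigma>) = [\<pi> j, \<pi> (Suc j)] \<longleftrightarrow>
      inv \<sigma> (\<pi> (Suc j)) < inv \<sigma> (\<pi> j)" if "j \<in> {1..<n}" for j
  proof -
    have ne: "\<pi> j \<noteq> \<pi> (Suc j)" using permutes_inj[OF \<pi>] by (metis injD n_not_Suc_n)
    then have "inv \<sigma> (\<pi> j) \<noteq> inv \<sigma> (\<pi> (Suc j))"
      using permutes_inj[OF permutes_inv[OF \<sigma>]] by (metis injD)
    moreover have "\<pi> j \<in> {1..n}" "\<pi> (Suc j) \<in> {1..n}"
      unfolding permutes_in_image[OF \<pi>] using that by auto
    ultimately show ?thesis
      using filter_word_of[OF \<sigma> _ _ ne] ne by auto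
  qed
  then show ?thesis by (auto simp: inverted_pairs_def descents_eq)
qed

lemma permutes_no_descents:
  assumes \<tau>: "\<tau> permutes {1..n}" and "descents n \<tau> = {}"
  shows "\<tau> = id"
proof -
  have "sorted (map \<tau> [1..<Suc n])"
    unfolding sorted_iff_nth_Suc
  proof (intro allI impI)
    fix i assume i: "Suc i < length (map \<tau> [1..<Suc n])"
    then have "Suc i \<in> {1..<n}" by (simp del: upt_Suc)
    moreover have "Suc i \<notin> descents n \<tau>" using assms(2) by simp
    ultimately have "\<tau> (Suc i) \<le> \<tau> (Suc (Suc i))" by (simp add: descents_eq)
    with i show "map \<tau> [1..<Suc n] ! i \<le> map \<tau> [1..<Suc n] ! Suc i" by (simp del: upt_Suc)
  qed
  moreover have "set (map \<tau> [1..<Suc n]) = set [1..<Suc n]"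
    using permutes_image[OF \<tau>] by (simp add: atLeastLessThanSuc_atLeastAtMost del: upt_Suc)
  ultimately have "map \<tau> [1..<Suc n] = [1..<Suc n]"
    using permutes_inj_on[OF \<tau>]
    by (intro sorted_distinct_set_unique) (auto simp: distinct_map simp del: upt_Suc)
  then have "map \<tau> [1..<Suc n] = map id [1..<Suc n]" by (simp only: list.map_id)
  then have "\<forall>i\<in>{1..n}. \<tau> i = i" unfolding map_eq_conv by (simp del: upt_Suc)
  then show ?thesis using permutes_not_in[OF \<tau>] by fastforce
qed

text \<open>
  Ignoring the relative order of \<open>\<pi> j0\<close> and \<open>\<pi> (j0 + 1)\<close> leaves conditions only inside the blocks
  \<open>\<pi> ` {1..j0}\<close> and \<open>\<pi> ` {j0+1..n}\<close>, so the words fall into complete shuffle classes.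
\<close>

lemma sum_cyclic_weight_inverted_pairs_diff:
  assumes \<pi>: "\<pi> permutes {1..n}" and j0: "j0 \<in> {1..<n}"
    and one: "prod q {1..n} = 1"
    and ne: "\<And>A. A \<noteq> {} \<Longrightarrow> A \<subset> {1..n} \<Longrightarrow> prod q A \<noteq> 1"
  shows "(\<Sum>w | w \<in> permutations_of_set {1..n} \<and> inverted_pairs n \<pi> w - {j0} = T. cyclic_weight q w) = 0"
    (is "sum _ ?W = 0")
proof -
  define B where "B = \<pi> ` {1..j0}"
  \<comment> \<open>\<open>h\<close> splits a word into its subwords inside and outside the block
    \<open>B\<close>; its fibers turn out to be shuffle classes.\<close>
  define h where "h w = (filter (\<lambda>z. z \<in> B) w, filter (\<lambda>z. z \<notin> B) w)" for w :: "nat list"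
  \<comment> \<open>\<open>\<pi> 1\<close> and \<open>\<pi> n\<close> witness that neither block is
    empty, so both shuffled words are nonempty.\<close>
  have B: "B \<subseteq> {1..n}" "\<pi> 1 \<in> B" "\<pi> n \<notin> B" "\<pi> n \<in> {1..n}"
    using j0 permutes_image[OF \<pi>] permutes_inj[OF \<pi>] by (auto simp: B_def inj_image_mem_iff)
  have inB: "\<pi> j \<in> B \<longleftrightarrow> j \<in> {1..j0}" for j
    using permutes_inj[OF \<pi>] by (auto simp: B_def inj_image_mem_iff)
  have fiber: "{w \<in> ?W. h w = h w0} = shuffles (fst (h w0)) (snd (h w0))" if w0: "w0 \<in> ?W" for w0
  proof (intro equalityI subsetI)
    fix w assume "w \<in> {w \<in> ?W. h w = h w0}"
    then show "w \<in> shuffles (fst (h w0)) (snd (h w0))"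
      using partition_in_shuffles[of w "\<lambda>z. z \<in> B"] by (auto simp: h_def)
  next
    fix w assume w: "w \<in> shuffles (fst (h w0)) (snd (h w0))"
    have set0: "set w0 = {1..n}" "distinct w0" using w0 by (auto dest: permutations_of_setD)
    have su: "set (fst (h w0)) = B" "set (fst (h w0)) \<inter> set (snd (h w0)) = {}"
      using B(1) set0 by (auto simp: h_def)
    have hw: "h w = h w0"
      using filter_shuffles_disjoint1[OF su(2) w] unfolding su(1) by (simp add: h_def)
    have "set w = {1..n}" using set_shuffles[OF w] set0 by (auto simp: h_def)
    moreover have "distinct w"
      using distinct_disjoint_shuffles[OF _ _ su(2) w] set0 by (simp add: h_def)
    ultimately have perm: "w \<in> permutations_of_set {1..n}" by auto
    \<comment> \<open>For \<open>j\<close> other than \<open>j0\<close> both letters lie in the same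
      block, and shuffling keeps the subword of each block.\<close>
    have "filter (\<lambda>z. z \<in> {\<pi> j, \<pi> (Suc j)}) w = filter (\<lambda>z. z \<in> {\<pi> j, \<pi> (Suc j)}) w0"
      if "j \<noteq> j0" "j \<in> {1..<n}" for j
    proof (cases "j < j0")
      case True
      then have "\<pi> j \<in> B" "\<pi> (Suc j) \<in> B" unfolding inB using that by auto
      then show ?thesis using hw by (intro filter_pair_cong[where P = "\<lambda>z. z \<in> B"]) (auto simp: h_def)
    next
      case False
      then have "\<pi> j \<notin> B" "\<pi> (Suc j) \<notin> B" unfolding inB using that by auto
      then show ?thesis using hw by (intro filter_pair_cong[where P = "\<lambda>z. z \<notin> B"]) (auto simp: h_def)
    qed
    then have "inverted_pairs n \<pi> w - {j0} = inverted_pairs n \<pi> w0 - {j0}"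
      unfolding inverted_pairs_def by (auto simp del: insert_iff)
    with perm hw w0 show "w \<in> {w \<in> ?W. h w = h w0}" by auto
  qed
  have "(\<Sum>w\<in>?W. cyclic_weight q w) = (\<Sum>p\<in>h ` ?W. \<Sum>w\<in>{w \<in> ?W. h w = p}. cyclic_weight q w)"
    by (rule sum.image_gen) simp
  also have "\<dots> = 0"
  proof (rule sum.neutral, rule ballI)
    fix p assume "p \<in> h ` ?W"
    then obtain w0 where w0: "w0 \<in> ?W" and p: "p = h w0" by blast
    then have set0: "set w0 = {1..n}" "distinct w0" by (auto dest: permutations_of_setD)
    have "set (fst (h w0) @ snd (h w0)) = set w0" by (auto simp: h_def)
    then have set_eq: "set (fst (h w0) @ snd (h w0)) = {1..n}" using set0(1) by (rule trans)
    have dist: "distinct (fst (h w0) @ snd (h w0))" using set0(2) by (auto simp: h_def)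
    have "fst (h w0) \<noteq> []" "snd (h w0) \<noteq> []"
      using B set0 by (auto simp: h_def filter_empty_conv)
    then have "(\<Sum>w\<in>shuffles (fst (h w0)) (snd (h w0)). cyclic_weight q w) = 0"
      by (intro sum_cyclic_weight_shuffles dist) (simp_all only: set_eq one ne not_False_eq_True)
    then show "(\<Sum>w\<in>{w \<in> ?W. h w = p}. cyclic_weight q w) = 0"
      unfolding p fiber[OF w0] .
  qed
  finally show ?thesis .
qed

text \<open>Induction on \<open>T\<close>. Only the word of \<pi> itself has no inverted pairs, and
  adding \<open>j\<close> to \<open>T\<close> flips the sign because the classes of \<open>T\<close>
  and \<open>insert j T\<close> together have sum zero.\<close>

lemma sum_cyclic_weight_inverted_pairs:
  assumes \<pi>: "\<pi> permutes {1..n}" and "T \<subseteq> {1..<n}"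
    and one: "prod q {1..n} = 1"
    and ne: "\<And>A. A \<noteq> {} \<Longrightarrow> A \<subset> {1..n} \<Longrightarrow> prod q A \<noteq> 1"
  shows "(\<Sum>w | w \<in> permutations_of_set {1..n} \<and> inverted_pairs n \<pi> w = T. cyclic_weight q w) =
    (- 1) ^ card T * cyclic_weight q (word_of n \<pi>)"
proof -
  have "finite T" using assms(2) finite_subset by blast
  from this assms(2) show ?thesis
  proof (induction T rule: finite_induct)
    case empty
    have "w = word_of n \<pi>" if w: "w \<in> permutations_of_set {1..n}" "inverted_pairs n \<pi> w = {}" for w
    proof -
      obtain \<sigma> where \<sigma>: "\<sigma> permutes {1..n}" "w = word_of n \<sigma>"
        using w(1) bij_betw_imp_surj_on[OF bij_betw_word_of[of n]] by blast
      have "inv \<sigma> \<circ> \<pi> = id"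
        using w(2) \<sigma> \<pi> by (intro permutes_no_descents[of _ n] permutes_compose permutes_inv)
          (auto simp: inverted_pairs_word_of)
      then have "\<sigma> \<circ> (inv \<sigma> \<circ> \<pi>) = \<sigma>" by simp
      then have "\<sigma> = \<pi>" using permutes_inv_o(1)[OF \<sigma>(1)] by (simp add: o_assoc)
      with \<sigma> show ?thesis by simp
    qed
    moreover have "inverted_pairs n \<pi> (word_of n \<pi>) = {}"
      using inverted_pairs_word_of[OF \<pi> \<pi>] permutes_inv_o(2)[OF \<pi>] by (simp add: descents_eq)
    moreover have "word_of n \<pi> \<in> permutations_of_set {1..n}"
      using bij_betwE[OF bij_betw_word_of[of n]] \<pi> by blast
    ultimately have "{w. w \<in> permutations_of_set {1..n} \<and> inverted_pairs n \<pi> w = {}} = {word_of n \<pi>}"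
      by blast
    then show ?case by simp
  next
    case (insert j T)
    let ?N = "\<lambda>T. {w. w \<in> permutations_of_set {1..n} \<and> inverted_pairs n \<pi> w = T}"
    \<comment> \<open>Since \<open>j\<close> is not in \<open>T\<close>, ignoring \<open>j\<close>
      merges exactly these two classes.\<close>
    have "{w. w \<in> permutations_of_set {1..n} \<and> inverted_pairs n \<pi> w - {j} = T} = ?N (insert j T) \<union> ?N T"
      using insert.hyps by auto
    then have "0 = (\<Sum>w\<in>?N (insert j T) \<union> ?N T. cyclic_weight q w)"
      using sum_cyclic_weight_inverted_pairs_diff[OF \<pi> _ one ne, of j T] insert.prems by simp
    also have "\<dots> = (\<Sum>w\<in>?N (insert j T). cyclic_weight q w) + (\<Sum>w\<in>?N T. cyclic_weight q w)"
      by (rule sum.union_disjoint) (use insert.hyps in auto)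
    finally show ?case
      using insert.IH insert.prems insert.hyps by (simp add: eq_neg_iff_add_eq_0)
  qed
qed

text \<open>Grouping by \<open>T = descents n (inv \<sigma> \<circ> \<pi>)\<close> gives the weight
  of \<pi> times the alternating sum of \<open>prod y T\<close> over all \<open>T\<close>, which is
  the expansion of the product on the right.\<close>

lemma sum_cyclic_weight_descents:
  assumes \<pi>: "\<pi> permutes {1..n}"
    and one: "prod q {1..n} = 1"
    and ne: "\<And>A. A \<noteq> {} \<Longrightarrow> A \<subset> {1..n} \<Longrightarrow> prod q A \<noteq> 1"
  shows "(\<Sum>\<sigma> | \<sigma> permutes {1..n}. cyclic_weight q (word_of n \<sigma>) * (\<Prod>j\<in>descents n (inv \<sigma> \<circ> \<pi>). y j)) =
    cyclic_weight q (word_of n \<pi>) * (\<Prod>j\<in>{1..<n}. 1 - y j)"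
proof -
  let ?g = "\<lambda>w. cyclic_weight q w * (\<Prod>j\<in>inverted_pairs n \<pi> w. y j)"
  have "(\<Sum>\<sigma> | \<sigma> permutes {1..n}. cyclic_weight q (word_of n \<sigma>) * (\<Prod>j\<in>descents n (inv \<sigma> \<circ> \<pi>). y j)) =
      (\<Sum>\<sigma> | \<sigma> permutes {1..n}. ?g (word_of n \<sigma>))"
    using \<pi> by (intro sum.cong refl) (simp add: inverted_pairs_word_of)
  also have "\<dots> = sum ?g (permutations_of_set {1..n})"
    by (rule sum.reindex_bij_betw[OF bij_betw_word_of])
  also have "\<dots> = (\<Sum>T\<in>Pow {1..<n}. sum ?g {w \<in> permutations_of_set {1..n}. inverted_pairs n \<pi> w = T})"
    by (rule sum.group[symmetric]) (auto simp: inverted_pairs_def)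
  also have "\<dots> = (\<Sum>T\<in>Pow {1..<n}. cyclic_weight q (word_of n \<pi>) * ((- 1) ^ card T * prod y T))"
  proof (rule sum.cong[OF refl])
    fix T assume T: "T \<in> Pow {1..<n}"
    have "sum ?g {w \<in> permutations_of_set {1..n}. inverted_pairs n \<pi> w = T} =
        (\<Sum>w | w \<in> permutations_of_set {1..n} \<and> inverted_pairs n \<pi> w = T. cyclic_weight q w) * prod y T"
      by (simp add: sum_distrib_right)
    also have "\<dots> = cyclic_weight q (word_of n \<pi>) * ((- 1) ^ card T * prod y T)"
      using T by (subst sum_cyclic_weight_inverted_pairs[OF \<pi> _ one ne]) auto
    finally show "sum ?g {w \<in> permutations_of_set {1..n}. inverted_pairs n \<pi> w = T} = \<dots>" .
  qed
  also have "\<dots> = cyclic_weight q (word_of n \<pi>) * (\<Prod>j\<in>{1..<n}. 1 - y j)"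
    by (subst prod_diff_conv_sum) (simp_all add: sum_distrib_left)
  finally show ?thesis .
qed

section \<open>Explicit products for the weights of permutation words\<close>

lemma prod_list_word_of:
  fixes q :: "nat \<Rightarrow> 'f::comm_monoid_mult"
  shows "prod_list (map q (word_of m \<sigma>)) = (\<Prod>j=1..m. q (\<sigma> j))"
  by (induction m) (simp_all add: word_of_def mult.commute)

text \<open>\<open>\<sigma> (Suc m)\<close> serves as virtual letter after the first
  \<open>m\<close> positions, so that a descent at \<open>m\<close> is counted; in this form the
  induction on \<open>m\<close> closes.\<close>

lemma word_weight_word_of:
  "word_weight q (\<sigma> (Suc m)) (word_of m \<sigma>) =
    (\<Prod>j | j \<in> {1..m} \<and> \<sigma> (Suc j) < \<sigma> j. \<Prod>i=1..j. q (\<sigma> i)) / (\<Prod>i=1..m. 1 - (\<Prod>j=1..i. q (\<sigma> j)))"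
proof (induction m)
  case 0
  then show ?case by (simp add: word_of_def)
next
  case (Suc m)
  have P: "prod_list (map q (\<sigma> (Suc m) # word_of m \<sigma>)) = (\<Prod>j=1..Suc m. q (\<sigma> j))"
    by (simp add: prod_list_word_of mult.commute)
  have W: "word_of (Suc m) \<sigma> = \<sigma> (Suc m) # word_of m \<sigma>"
    by (simp add: word_of_def)
  have "{j. j \<in> {1..Suc m} \<and> \<sigma> (Suc j) < \<sigma> j} =
      (if \<sigma> (Suc (Suc m)) < \<sigma> (Suc m) then insert (Suc m) {j. j \<in> {1..m} \<and> \<sigma> (Suc j) < \<sigma> j}
       else {j. j \<in> {1..m} \<and> \<sigma> (Suc j) < \<sigma> j})"
    by (auto simp: le_Suc_eq)
  then show ?case
    unfolding W word_weight.simps P Suc.IH by simp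
qed

text \<open>Identifies \<open>cyclic_weight\<close> with the coefficients of \<open>e_elem\<close>:
  the head \<open>\<sigma> n\<close> of the word is the virtual letter for the other
  \<open>n - 1\<close> letters.\<close>

lemma cyclic_weight_word_of:
  assumes "n \<ge> 1"
  shows "cyclic_weight q (word_of n \<sigma>) =
    (\<Prod>j\<in>descents n \<sigma>. \<Prod>i=1..j. q (\<sigma> i)) / (\<Prod>i=1..n-1. 1 - (\<Prod>j=1..i. q (\<sigma> j)))"
proof -
  obtain m where n: "n = Suc m" using assms by (cases n) auto
  have W: "word_of n \<sigma> = \<sigma> (Suc m) # word_of m \<sigma>" by (simp add: word_of_def n)
  have D: "descents n \<sigma> = {j. j \<in> {1..m} \<and> \<sigma> (Suc j) < \<sigma> j}" by (auto simp: descents_eq n)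
  show ?thesis unfolding W D by (simp add: word_weight_word_of n)
qed

section \<open>Rational functions and the permutation action\<close>

lemma const_ratfun_0 [simp]: "const_ratfun 0 = 0"
  and const_ratfun_1 [simp]: "const_ratfun 1 = 1"
  by (simp_all add: const_ratfun_def Zero_fract_def One_fract_def)

lemma const_ratfun_add: "const_ratfun (a + b) = const_ratfun a + const_ratfun b"
  by (simp add: const_ratfun_def single_add)

lemma const_ratfun_mult: "const_ratfun (a * b) = const_ratfun a * const_ratfun b"
  by (simp add: const_ratfun_def mult_single)

lemma prod_power_keys_superset:
  fixes x :: "nat \<Rightarrow> 'a::comm_semiring_1"
  assumes "finite A" "Poly_Mapping.keys m \<subseteq> A"
  shows "(\<Prod>i\<in>Poly_Mapping.keys m. x i ^ Poly_Mapping.lookup m i) = (\<Prod>i\<in>A. x i ^ Poly_Mapping.lookup m i)"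
  using assms by (intro prod.mono_neutral_left) (auto simp: in_keys_iff)

lemma prod_power_keys_add:
  fixes x :: "nat \<Rightarrow> 'a::comm_semiring_1"
  shows "(\<Prod>i\<in>Poly_Mapping.keys (a + b). x i ^ Poly_Mapping.lookup (a + b) i) =
    (\<Prod>i\<in>Poly_Mapping.keys a. x i ^ Poly_Mapping.lookup a i) *
    (\<Prod>i\<in>Poly_Mapping.keys b. x i ^ Poly_Mapping.lookup b i)"
proof -
  let ?A = "Poly_Mapping.keys a \<union> Poly_Mapping.keys b"
  have "Poly_Mapping.keys (a + b) \<subseteq> ?A" by (rule Poly_Mapping.keys_add)
  then show ?thesis
    by (subst (1 2 3) prod_power_keys_superset[of ?A]) (auto simp: lookup_add power_add prod.distrib)
qed

lemma sum_single_lookup: "(\<Sum>m\<in>Poly_Mapping.keys P. Poly_Mapping.single m (Poly_Mapping.lookup P m)) = P"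
  by (rule poly_mapping_eqI) (auto simp: lookup_sum lookup_single when_def in_keys_iff)

section \<open>Evaluation as a ring homomorphism\<close>

lemma eval_mpoly_0 [simp]: "eval_mpoly x 0 = 0"
  by (simp add: eval_mpoly_def)

lemma eval_mpoly_single:
  "eval_mpoly x (Poly_Mapping.single m c) =
    const_ratfun c * (\<Prod>i\<in>Poly_Mapping.keys m. x i ^ Poly_Mapping.lookup m i)"
  by (simp add: eval_mpoly_def)

lemma eval_mpoly_1 [simp]: "eval_mpoly x 1 = 1"
  using eval_mpoly_single[of x 0 1] by simp

lemma eval_mpoly_add: "eval_mpoly x (P + Q) = eval_mpoly x P + eval_mpoly x Q"
  unfolding eval_mpoly_def
  by (rule setsum_keys_plus_distrib[where f = "\<lambda>m c. const_ratfun c *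
    (\<Prod>i\<in>Poly_Mapping.keys m. x i ^ Poly_Mapping.lookup m i)"])
    (simp_all add: const_ratfun_add distrib_right)

lemma eval_mpoly_sum: "eval_mpoly x (sum f A) = (\<Sum>a\<in>A. eval_mpoly x (f a))"
  by (induction A rule: infinite_finite_induct) (simp_all add: eval_mpoly_add)

text \<open>By bilinearity it suffices to treat monomials, where exponents add.\<close>

lemma eval_mpoly_mult: "eval_mpoly x (P * Q) = eval_mpoly x P * eval_mpoly x Q"
proof -
  let ?s = "\<lambda>P m. Poly_Mapping.single m (Poly_Mapping.lookup P m)"
  have "eval_mpoly x (P * Q) =
      eval_mpoly x ((\<Sum>m\<in>Poly_Mapping.keys P. ?s P m) * (\<Sum>m\<in>Poly_Mapping.keys Q. ?s Q m))"
    by (simp only: sum_single_lookup)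
  also have "\<dots> = (\<Sum>a\<in>Poly_Mapping.keys P. \<Sum>b\<in>Poly_Mapping.keys Q. eval_mpoly x (?s P a) * eval_mpoly x (?s Q b))"
    unfolding sum_product eval_mpoly_sum mult_single eval_mpoly_single const_ratfun_mult prod_power_keys_add
    by (simp only: mult_ac)
  also have "\<dots> = eval_mpoly x P * eval_mpoly x Q"
    unfolding sum_product[symmetric] eval_mpoly_sum[symmetric] sum_single_lookup ..
  finally show ?thesis .
qed

section \<open>K(q) as a subfield of the fraction field\<close>

lemma Kq_polys_0 [simp]: "0 \<in> Kq_polys n"
  and Kq_polys_1 [simp]: "1 \<in> Kq_polys n"
  by (simp_all add: Kq_polys_def poly_vars_def)

lemma Kq_polys_add: "P \<in> Kq_polys n \<Longrightarrow> Q \<in> Kq_polys n \<Longrightarrow> P + Q \<in> Kq_polys n"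
  using Poly_Mapping.keys_add[of P Q] unfolding Kq_polys_def poly_vars_def by blast

lemma Kq_polys_uminus: "P \<in> Kq_polys n \<Longrightarrow> - P \<in> Kq_polys n"
  by (auto simp: Kq_polys_def poly_vars_def in_keys_iff)

lemma Kq_polys_mult:
  assumes "P \<in> Kq_polys n" "Q \<in> Kq_polys n"
  shows "P * Q \<in> Kq_polys n"
proof -
  have "Poly_Mapping.keys m \<subseteq> {1..<n}" if "m \<in> Poly_Mapping.keys (P * Q)" for m
  proof -
    from that obtain a b where "m = a + b" "a \<in> Poly_Mapping.keys P" "b \<in> Poly_Mapping.keys Q"
      using Poly_Mapping.keys_mult[of P Q] by blast
    then show ?thesis
      using assms Poly_Mapping.keys_add[of a b] by (fastforce simp: Kq_polys_def poly_vars_def)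
  qed
  then show ?thesis by (auto simp: Kq_polys_def poly_vars_def)
qed

lemma KqE:
  assumes "f \<in> Kq n"
  obtains P Q where "f = Fract P Q" "P \<in> Kq_polys n" "Q \<in> Kq_polys n" "Q \<noteq> 0"
  using assms by (auto simp: Kq_def)

lemma KqI: "P \<in> Kq_polys n \<Longrightarrow> Q \<in> Kq_polys n \<Longrightarrow> Q \<noteq> 0 \<Longrightarrow> Fract P Q \<in> Kq n"
  by (auto simp: Kq_def)

lemma Kq_0 [simp]: "0 \<in> Kq n" and Kq_1 [simp]: "1 \<in> Kq n"
  unfolding Zero_fract_def One_fract_def by (rule KqI; simp)+

lemma Kq_add: "f \<in> Kq n \<Longrightarrow> g \<in> Kq n \<Longrightarrow> f + g \<in> Kq n"
  by (auto elim!: KqE intro!: KqI Kq_polys_add Kq_polys_mult)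

lemma Kq_diff: "f \<in> Kq n \<Longrightarrow> g \<in> Kq n \<Longrightarrow> f - g \<in> Kq n"
  unfolding diff_conv_add_uminus
  by (rule Kq_add) (auto elim!: KqE intro!: KqI Kq_polys_uminus)

lemma Kq_mult: "f \<in> Kq n \<Longrightarrow> g \<in> Kq n \<Longrightarrow> f * g \<in> Kq n"
  by (auto elim!: KqE intro!: KqI Kq_polys_mult)

lemma Kq_inverse:
  assumes "f \<in> Kq n"
  shows "inverse f \<in> Kq n"
proof (cases "f = 0")
  case False
  from assms obtain P Q where PQ: "f = Fract P Q" "P \<in> Kq_polys n" "Q \<in> Kq_polys n" "Q \<noteq> 0"
    by (rule KqE)
  with False have "P \<noteq> 0" by (auto simp: fract_collapse)
  with PQ show ?thesis by (auto intro!: KqI)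
qed simp

lemma Kq_divide: "f \<in> Kq n \<Longrightarrow> g \<in> Kq n \<Longrightarrow> f / g \<in> Kq n"
  unfolding divide_inverse by (intro Kq_mult Kq_inverse)

lemma Kq_prod: "(\<And>i. i \<in> A \<Longrightarrow> f i \<in> Kq n) \<Longrightarrow> prod f A \<in> Kq n"
  by (induction A rule: infinite_finite_induct) (auto intro: Kq_mult)

lemma Kq_var: "i \<in> {1..<n} \<Longrightarrow> var_ratfun i \<in> Kq n"
  unfolding var_ratfun_def by (rule KqI) (auto simp: Kq_polys_def poly_vars_def)

lemma Kq_qvar: "i \<in> {1..n} \<Longrightarrow> qvar n i \<in> Kq n"
  unfolding qvar_def by (auto intro!: Kq_inverse Kq_prod Kq_var)

lemma var_ratfun_nonzero [simp]: "var_ratfun i \<noteq> (0 :: 'k::field ratfun)"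
proof -
  have "Poly_Mapping.single (Poly_Mapping.single i (1::nat)) (1::'k) \<noteq> 0"
    by (metis lookup_single_eq lookup_zero zero_neq_one)
  then show ?thesis by (simp add: var_ratfun_def Zero_fract_def eq_fract)
qed

section \<open>Monomials and products of the q_i\<close>

lemma sum_Fract_1: "(\<Sum>a\<in>A. Fract (f a) 1) = Fract (sum f A) 1"
  by (induction A rule: infinite_finite_induct) (simp_all add: Zero_fract_def)

lemma prod_var_power:
  assumes "finite A"
  shows "(\<Prod>i\<in>A. var_ratfun i ^ a i) =
    (Fract (Poly_Mapping.single (\<Sum>i\<in>A. Poly_Mapping.single i (a i)) 1) 1 :: 'k::field ratfun)"
  using assms
proof (induction A rule: finite_induct)
  case (insert j A)
  have "var_ratfun j ^ k = (Fract (Poly_Mapping.single (Poly_Mapping.single j k) 1) 1 :: 'k ratfun)" for k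
    by (induction k) (simp_all add: One_fract_def var_ratfun_def mult_single single_add[symmetric])
  with insert show ?case by (simp add: mult_single)
qed (simp add: One_fract_def)

lemma lookup_sum_single:
  "finite A \<Longrightarrow> Poly_Mapping.lookup (\<Sum>i\<in>A. Poly_Mapping.single i (a i)) k = (if k \<in> A then a k else 0)"
  by (simp add: lookup_sum lookup_single when_def)

lemma prod_qvar:
  assumes "n \<ge> 1"
  shows "(\<Prod>i=1..n. qvar n i) = (1 :: 'k::field ratfun)"
proof -
  have "{1..n} = insert n {1..<n}" using assms by auto
  then have "(\<Prod>i=1..n. qvar n i) = qvar n n * (\<Prod>i\<in>{1..<n}. qvar n i :: 'k ratfun)"
    by simp
  also have "(\<Prod>i\<in>{1..<n}. qvar n i) = (\<Prod>i\<in>{1..<n}. var_ratfun i :: 'k ratfun)"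
    by (intro prod.cong) (auto simp: qvar_def)
  finally show ?thesis by (simp add: qvar_def)
qed

text \<open>If \<open>n\<close> is not in \<open>A\<close>, the product is a nonconstant monomial.
  Otherwise it is the inverse of the product over the complement, to which the first case
  applies.\<close>

lemma prod_qvar_neq_1:
  assumes "n \<ge> 1" and "A \<noteq> {}" "A \<subset> {1..n}"
  shows "(\<Prod>i\<in>A. qvar n i) \<noteq> (1 :: 'k::field ratfun)"
proof -
  have *: "(\<Prod>i\<in>A. qvar n i) \<noteq> (1 :: 'k::field ratfun)" if A: "A \<noteq> {}" "A \<subseteq> {1..n}" "n \<notin> A" for A
  proof
    assume "(\<Prod>i\<in>A. qvar n i) = (1 :: 'k ratfun)"
    moreover have "(\<Prod>i\<in>A. qvar n i) = (\<Prod>i\<in>A. var_ratfun i ^ (\<lambda>_. 1) i :: 'k ratfun)"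
      using A by (intro prod.cong) (auto simp: qvar_def)
    moreover have "finite A" using A finite_subset by blast
    ultimately have "Poly_Mapping.single (\<Sum>i\<in>A. Poly_Mapping.single i (1::nat)) 1 = (1 :: 'k mpoly)"
      unfolding prod_var_power[OF \<open>finite A\<close>] by (simp add: One_fract_def eq_fract)
    then have "Poly_Mapping.keys (Poly_Mapping.single (\<Sum>i\<in>A. Poly_Mapping.single i (1::nat)) (1::'k)) =
        Poly_Mapping.keys (1 :: 'k mpoly)"
      by simp
    then have "(\<Sum>i\<in>A. Poly_Mapping.single i (1::nat)) = 0"
      by simp
    moreover obtain k where "k \<in> A" using A by auto
    ultimately show False
      using lookup_sum_single[OF \<open>finite A\<close>, of "\<lambda>_. 1::nat" k] by simp
  qed
  show ?thesis
  proof (cases "n \<in> A")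
    case True
    have "(\<Prod>i\<in>A. qvar n i) * (\<Prod>i\<in>{1..n} - A. qvar n i) = (1 :: 'k ratfun)"
      using prod.subset_diff[of A "{1..n}" "qvar n :: nat \<Rightarrow> 'k ratfun"] assms prod_qvar[OF assms(1), where 'k = 'k]
      by (auto simp: mult.commute)
    moreover have "(\<Prod>i\<in>{1..n} - A. qvar n i) \<noteq> (1 :: 'k ratfun)"
      using assms True by (intro *) auto
    ultimately show ?thesis by auto
  next
    case False
    with assms show ?thesis by (intro *) auto
  qed
qed

text \<open>
  Multiplying by a high power of \<open>q_1 \<cdots> q_{n-1}\<close> clears the negative exponents, and the exponent
  vectors of distinct monomials of \<open>P\<close> stay distinct.
\<close>

lemma eval_mpoly_permuted_nonzero:
  fixes P :: "'k::field mpoly"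
  assumes n: "n \<ge> 1" and \<sigma>: "\<sigma> permutes {1..n}" and P: "P \<in> Kq_polys n" "P \<noteq> 0"
  shows "eval_mpoly (\<lambda>i. qvar n (\<sigma> i)) P \<noteq> 0"
proof -
  define X :: "'k ratfun" where "X = (\<Prod>j\<in>{1..<n}. var_ratfun j)"
  \<comment> \<open>\<open>s\<close> is the index whose variable is replaced by
    \<open>qvar n n = inverse X\<close>, and \<open>N\<close> bounds its exponent in all monomials
    of \<open>P\<close>.\<close>
  define s where "s = inv \<sigma> n"
  define N where "N = (\<Sum>m\<in>Poly_Mapping.keys P. Poly_Mapping.lookup m s)"
  \<comment> \<open>\<open>e m\<close> is the exponent vector of the image of \<open>m\<close> times
    \<open>X ^ N\<close>: the leftover power of \<open>X\<close> adds \<open>N\<close> minus the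
    exponent of \<open>s\<close> to each entry.\<close>
  define e where "e m = (\<Sum>k\<in>{1..<n}. Poly_Mapping.single k
    (Poly_Mapping.lookup m (inv \<sigma> k) + (N - Poly_Mapping.lookup m s)))" for m
  have X: "X \<noteq> 0" by (simp add: X_def)
  have keys: "Poly_Mapping.keys m \<subseteq> {1..<n}" if "m \<in> Poly_Mapping.keys P" for m
    using that P(1) by (auto simp: Kq_polys_def poly_vars_def)
  have le: "Poly_Mapping.lookup m s \<le> N" if "m \<in> Poly_Mapping.keys P" for m
    unfolding N_def by (rule member_le_sum) (use that in auto)
  have n_split: "{1..n} = insert n {1..<n}" using n by auto
  have mon: "(\<Prod>i\<in>Poly_Mapping.keys m. qvar n (\<sigma> i) ^ Poly_Mapping.lookup m i) * X ^ N =
      Fract (Poly_Mapping.single (e m) 1) 1" if m: "m \<in> Poly_Mapping.keys P" for m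
  proof -
    have "(\<Prod>i\<in>Poly_Mapping.keys m. qvar n (\<sigma> i) ^ Poly_Mapping.lookup m i) =
        (\<Prod>i\<in>{1..n}. qvar n (\<sigma> i) ^ Poly_Mapping.lookup m (inv \<sigma> (\<sigma> i)) :: 'k ratfun)"
      unfolding permutes_inverses(2)[OF \<sigma>]
      by (rule prod_power_keys_superset) (use keys[OF m] in auto)
    also have "\<dots> = (\<Prod>k\<in>{1..n}. qvar n k ^ Poly_Mapping.lookup m (inv \<sigma> k))"
      by (rule prod.permute[OF \<sigma>, unfolded o_def, symmetric])
    also have "\<dots> = inverse X ^ Poly_Mapping.lookup m s *
        (\<Prod>k\<in>{1..<n}. var_ratfun k ^ Poly_Mapping.lookup m (inv \<sigma> k))"
      unfolding n_split by (simp add: qvar_def X_def s_def cong: prod.cong_simp)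
    finally have "(\<Prod>i\<in>Poly_Mapping.keys m. qvar n (\<sigma> i) ^ Poly_Mapping.lookup m i) * X ^ N =
        (\<Prod>k\<in>{1..<n}. var_ratfun k ^ Poly_Mapping.lookup m (inv \<sigma> k)) * X ^ (N - Poly_Mapping.lookup m s)"
      using X le[OF m] by (simp add: power_diff power_inverse field_simps)
    also have "\<dots> = (\<Prod>k\<in>{1..<n}. var_ratfun k ^
        (Poly_Mapping.lookup m (inv \<sigma> k) + (N - Poly_Mapping.lookup m s)))"
      by (simp add: X_def prod_power_distrib power_add prod.distrib)
    finally show ?thesis by (simp add: prod_var_power e_def)
  qed
  have inj: "m = m'" if m: "m \<in> Poly_Mapping.keys P" "m' \<in> Poly_Mapping.keys P" "e m = e m'" for m m'
  proof (rule poly_mapping_eqI)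
    have zero: "Poly_Mapping.lookup m i = 0" "Poly_Mapping.lookup m' i = 0" if "i \<notin> {1..<n}" for i
      using keys[OF m(1)] keys[OF m(2)] that by (auto simp: in_keys_iff)
    have *: "Poly_Mapping.lookup m i + (N - Poly_Mapping.lookup m s) =
        Poly_Mapping.lookup m' i + (N - Poly_Mapping.lookup m' s)" if "i \<in> {1..n}" for i
    proof (cases "\<sigma> i = n")
      case True
      then have "s = i" using permutes_inverses(2)[OF \<sigma>] by (auto simp: s_def)
      then show ?thesis using le[OF m(1)] le[OF m(2)] by simp
    next
      case False
      then have "\<sigma> i \<in> {1..<n}" using that permutes_in_image[OF \<sigma>, of i] by auto
      then show ?thesis
        using arg_cong[OF m(3), of "\<lambda>e. Poly_Mapping.lookup e (\<sigma> i)"]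
        by (simp add: e_def lookup_sum_single permutes_inverses(2)[OF \<sigma>])
    qed
    \<comment> \<open>Index \<open>n\<close> does not occur in the monomials of \<open>P\<close>, so
      the equation at \<open>n\<close> compares the shifts alone; they agree and cancel at every
      other index.\<close>
    from *[of n] have "N - Poly_Mapping.lookup m s = N - Poly_Mapping.lookup m' s"
      using n zero[of n] by simp
    with * zero show "Poly_Mapping.lookup m i = Poly_Mapping.lookup m' i" for i
      by (cases "i \<in> {1..<n}") auto
  qed
  let ?R = "\<Sum>m\<in>Poly_Mapping.keys P. Poly_Mapping.single (e m) (Poly_Mapping.lookup P m)"
  have "eval_mpoly (\<lambda>i. qvar n (\<sigma> i)) P * X ^ N =
      (\<Sum>m\<in>Poly_Mapping.keys P. const_ratfun (Poly_Mapping.lookup P m) * Fract (Poly_Mapping.single (e m) 1) 1)"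
    unfolding eval_mpoly_def sum_distrib_right mult.assoc by (intro sum.cong refl) (simp only: mon)
  also have "\<dots> = Fract ?R 1"
    by (simp add: sum_Fract_1 const_ratfun_def mult_single)
  finally have ev: "eval_mpoly (\<lambda>i. qvar n (\<sigma> i)) P * X ^ N = Fract ?R 1" .
  obtain m0 where m0: "m0 \<in> Poly_Mapping.keys P" using P(2) by (metis keys_eq_empty ex_in_conv)
  \<comment> \<open>Distinct monomials do not collide under \<open>e\<close>, so only
    \<open>m0\<close> contributes here.\<close>
  have "Poly_Mapping.lookup ?R (e m0) = (\<Sum>m\<in>Poly_Mapping.keys P. if m = m0 then Poly_Mapping.lookup P m else 0)"
    unfolding lookup_sum using m0 inj by (intro sum.cong refl) (auto simp: lookup_single when_def)
  also have "\<dots> = Poly_Mapping.lookup P m0" using m0 by simp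
  also have "\<dots> \<noteq> 0" using m0 by (simp add: in_keys_iff)
  finally have "?R \<noteq> 0" by auto
  then have "Fract ?R 1 \<noteq> 0" by (simp add: Zero_fract_def eq_fract)
  with ev show ?thesis by auto
qed

text \<open>Resolves the definite description: evaluation preserves the cross-multiplied equation of
  two equal fractions, and the evaluated denominators are nonzero by
  \<open>eval_mpoly_permuted_nonzero\<close>.\<close>

lemma perm_act_Fract:
  fixes P Q :: "'k::field mpoly"
  assumes n: "n \<ge> 1" and \<sigma>: "\<sigma> permutes {1..n}"
    and PQ: "P \<in> Kq_polys n" "Q \<in> Kq_polys n" "Q \<noteq> 0"
  shows "perm_act n \<sigma> (Fract P Q) =
    eval_mpoly (\<lambda>i. qvar n (\<sigma> i)) P / eval_mpoly (\<lambda>i. qvar n (\<sigma> i)) Q"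
proof -
  let ?ev = "eval_mpoly (\<lambda>i. qvar n (\<sigma> i)) :: 'k mpoly \<Rightarrow> _"
  have eq: "?ev P / ?ev Q = ?ev P' / ?ev Q'"
    if "Q' \<in> Kq_polys n" "Q' \<noteq> 0" "Fract P Q = Fract P' Q'" for P' Q'
  proof -
    have "P * Q' = P' * Q" using that PQ by (simp add: eq_fract)
    then have "?ev P * ?ev Q' = ?ev P' * ?ev Q" by (simp flip: eval_mpoly_mult)
    then show ?thesis
      using eval_mpoly_permuted_nonzero[OF n \<sigma> PQ(2,3)] eval_mpoly_permuted_nonzero[OF n \<sigma> that(1,2)]
      by (simp add: field_simps)
  qed
  show ?thesis
    unfolding perm_act_def by (rule the_equality) (use eq PQ in blast)+
qed

section \<open>The permutation action as a field homomorphism on K(q)\<close>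

context
  fixes n :: nat and \<sigma> :: "nat \<Rightarrow> nat"
  assumes n: "n \<ge> 1" and \<sigma>: "\<sigma> permutes {1..n}"
begin

lemma perm_act_0: "perm_act n \<sigma> 0 = (0 :: 'k::field ratfun)"
  unfolding Zero_fract_def by (subst perm_act_Fract[OF n \<sigma>]) (simp_all flip: Zero_fract_def)

lemma perm_act_1: "perm_act n \<sigma> 1 = (1 :: 'k::field ratfun)"
  unfolding One_fract_def by (subst perm_act_Fract[OF n \<sigma>]) (simp_all flip: One_fract_def)

lemma perm_act_add:
  fixes f g :: "'k::field ratfun"
  assumes "f \<in> Kq n" "g \<in> Kq n"
  shows "perm_act n \<sigma> (f + g) = perm_act n \<sigma> f + perm_act n \<sigma> g"
proof -
  obtain P Q where f: "f = Fract P Q" and PQ: "P \<in> Kq_polys n" "Q \<in> Kq_polys n" "Q \<noteq> 0"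
    using assms(1) by (rule KqE)
  obtain R S where g: "g = Fract R S" and RS: "R \<in> Kq_polys n" "S \<in> Kq_polys n" "S \<noteq> 0"
    using assms(2) by (rule KqE)
  show ?thesis
    using eval_mpoly_permuted_nonzero[OF n \<sigma> PQ(2,3)] eval_mpoly_permuted_nonzero[OF n \<sigma> RS(2,3)] PQ RS
    by (simp add: f g perm_act_Fract[OF n \<sigma>] Kq_polys_add Kq_polys_mult eval_mpoly_add eval_mpoly_mult
      add_frac_eq)
qed

lemma perm_act_diff:
  fixes f g :: "'k::field ratfun"
  assumes "f \<in> Kq n" "g \<in> Kq n"
  shows "perm_act n \<sigma> (f - g) = perm_act n \<sigma> f - perm_act n \<sigma> g"
  using perm_act_add[OF Kq_diff[OF assms] assms(2)] by simp

lemma perm_act_mult: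
  fixes f g :: "'k::field ratfun"
  assumes "f \<in> Kq n" "g \<in> Kq n"
  shows "perm_act n \<sigma> (f * g) = perm_act n \<sigma> f * perm_act n \<sigma> g"
  using assms by (auto elim!: KqE simp: perm_act_Fract[OF n \<sigma>] Kq_polys_mult eval_mpoly_mult)

lemma perm_act_inverse:
  fixes f :: "'k::field ratfun"
  assumes "f \<in> Kq n"
  shows "perm_act n \<sigma> (inverse f) = inverse (perm_act n \<sigma> f)"
proof (cases "f = 0")
  case False
  have "perm_act n \<sigma> f * perm_act n \<sigma> (inverse f) = 1"
    using False assms by (simp add: perm_act_1 flip: perm_act_mult[OF _ Kq_inverse])
  then show ?thesis by (metis inverse_unique)
qed (simp add: perm_act_0)

lemma perm_act_divide:
  fixes f g :: "'k::field ratfun"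
  assumes "f \<in> Kq n" "g \<in> Kq n"
  shows "perm_act n \<sigma> (f / g) = perm_act n \<sigma> f / perm_act n \<sigma> g"
  using assms by (simp add: divide_inverse perm_act_mult perm_act_inverse Kq_inverse)

lemma perm_act_prod:
  fixes f :: "'a \<Rightarrow> 'k::field ratfun"
  assumes "\<And>i. i \<in> A \<Longrightarrow> f i \<in> Kq n"
  shows "perm_act n \<sigma> (prod f A) = (\<Prod>i\<in>A. perm_act n \<sigma> (f i))"
  using assms
  by (induction A rule: infinite_finite_induct) (simp_all add: perm_act_1 perm_act_mult Kq_prod)

text \<open>For \<open>i < n\<close> this is the substitution itself. For \<open>i = n\<close> the
  value is forced: \<sigma> only permutes the factors of the product of all q_i, which is 1, so the
  image of the inverse of the first \<open>n - 1\<close> variables must be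
  \<open>qvar n (\<sigma> n)\<close>.\<close>

lemma perm_act_qvar:
  assumes "i \<in> {1..n}"
  shows "perm_act n \<sigma> (qvar n i) = (qvar n (\<sigma> i) :: 'k::field ratfun)"
proof -
  have var: "perm_act n \<sigma> (var_ratfun i) = (qvar n (\<sigma> i) :: 'k ratfun)" if "i \<in> {1..<n}" for i
    unfolding var_ratfun_def using that
    by (subst perm_act_Fract[OF n \<sigma>]) (auto simp: Kq_polys_def poly_vars_def eval_mpoly_single)
  show ?thesis
  proof (cases "i = n")
    case True
    have split: "{1..n} = insert n {1..<n}" using n by auto
    have "(\<Prod>j\<in>{1..n}. qvar n (\<sigma> j)) = (\<Prod>j=1..n. qvar n j :: 'k ratfun)"
      by (rule prod.permute[OF \<sigma>, unfolded o_def, symmetric])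
    then have "qvar n (\<sigma> n) * (\<Prod>j\<in>{1..<n}. qvar n (\<sigma> j)) = (1 :: 'k ratfun)"
      unfolding prod_qvar[OF n] unfolding split by simp
    then have "inverse (\<Prod>j\<in>{1..<n}. qvar n (\<sigma> j) :: 'k ratfun) = qvar n (\<sigma> n)"
      by (metis inverse_unique mult.commute)
    moreover have "(\<Prod>j\<in>{1..<n}. var_ratfun j :: 'k ratfun) \<in> Kq n"
      by (intro Kq_prod Kq_var)
    moreover have "perm_act n \<sigma> (\<Prod>j\<in>{1..<n}. var_ratfun j) = (\<Prod>j\<in>{1..<n}. qvar n (\<sigma> j) :: 'k ratfun)"
      by (subst perm_act_prod) (auto intro: Kq_var simp: var)
    moreover have "qvar n i = inverse (\<Prod>j\<in>{1..<n}. var_ratfun j :: 'k ratfun)"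
      using True by (simp add: qvar_def)
    ultimately show ?thesis
      using True by (simp only: perm_act_inverse)
  next
    case False
    then have "i \<in> {1..<n}" using assms by auto
    with var[OF this] False show ?thesis by (simp add: qvar_def[of n i])
  qed
qed

end

section \<open>The idempotent\<close>

lemma e_elem_eq:
  assumes "n \<ge> 1"
  shows "e_elem n = (\<Sum>\<sigma> | \<sigma> permutes {1..n}. Poly_Mapping.single \<sigma> (cyclic_weight (qvar n) (word_of n \<sigma>)))"
  using assms by (simp add: e_elem_def cyclic_weight_word_of)

lemma lookup_e_elem:
  assumes "n \<ge> 1"
  shows "Poly_Mapping.lookup (e_elem n) \<sigma> =
    (if \<sigma> permutes {1..n} then cyclic_weight (qvar n) (word_of n \<sigma>) else 0)"
  by (simp add: e_elem_eq[OF assms] lookup_sum_single finite_permutations)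

lemma prefix_prod_in_Kq:
  assumes "\<tau> permutes {1..n}" "j \<le> n"
  shows "(\<Prod>i=1..j. qvar n (\<tau> i)) \<in> Kq n"
proof (intro Kq_prod Kq_qvar)
  show "\<tau> i \<in> {1..n}" if "i \<in> {1..j}" for i
    unfolding permutes_in_image[OF assms(1)] using that assms(2) by auto
qed

lemma cyclic_weight_in_Kq:
  assumes "n \<ge> 1" "\<tau> permutes {1..n}"
  shows "cyclic_weight (qvar n) (word_of n \<tau>) \<in> Kq n"
  unfolding cyclic_weight_word_of[OF assms(1)]
  by (intro Kq_divide Kq_prod Kq_diff Kq_1 prefix_prod_in_Kq assms(2)) (auto simp: descents_def)

text \<open>The homomorphism rules carry the action into each prefix product; the work lies in
  checking that every intermediate factor lies in K(q), where these rules apply.\<close>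

lemma perm_act_cyclic_weight:
  assumes n: "n \<ge> 1" and \<sigma>: "\<sigma> permutes {1..n}" and \<tau>: "\<tau> permutes {1..n}"
  shows "perm_act n \<sigma> (cyclic_weight (qvar n) (word_of n \<tau>)) =
    ((\<Prod>j\<in>descents n \<tau>. \<Prod>i=1..j. qvar n (\<sigma> (\<tau> i))) /
     (\<Prod>i=1..n-1. 1 - (\<Prod>j=1..i. qvar n (\<sigma> (\<tau> j)))) :: 'k::field ratfun)"
proof -
  have prefix: "perm_act n \<sigma> (\<Prod>i=1..j. qvar n (\<tau> i)) = (\<Prod>i=1..j. qvar n (\<sigma> (\<tau> i)) :: 'k ratfun)"
    if "j \<le> n" for j
  proof -
    have "\<tau> i \<in> {1..n}" if "i \<in> {1..j}" for i
      unfolding permutes_in_image[OF \<tau>] using that \<open>j \<le> n\<close> by auto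
    then show ?thesis
      by (subst perm_act_prod[OF n \<sigma>]) (auto intro!: Kq_qvar prod.cong perm_act_qvar[OF n \<sigma>])
  qed
  have Kq: "(\<Prod>i=1..j. qvar n (\<tau> i)) \<in> (Kq n :: 'k ratfun set)" if "j \<le> n" for j
    by (rule prefix_prod_in_Kq[OF \<tau> that])
  have le: "j \<in> descents n \<tau> \<Longrightarrow> j \<le> n" "j \<in> {1..n-1} \<Longrightarrow> j \<le> n" for j
    by (auto simp: descents_def)
  have "perm_act n \<sigma> (\<Prod>j\<in>descents n \<tau>. \<Prod>i=1..j. qvar n (\<tau> i)) =
      (\<Prod>j\<in>descents n \<tau>. \<Prod>i=1..j. qvar n (\<sigma> (\<tau> i)) :: 'k ratfun)"
    by (subst perm_act_prod[OF n \<sigma>]) (use Kq prefix le in \<open>auto intro!: prod.cong\<close>)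
  moreover have "perm_act n \<sigma> (\<Prod>i=1..n-1. 1 - (\<Prod>j=1..i. qvar n (\<tau> j))) =
      (\<Prod>i=1..n-1. 1 - (\<Prod>j=1..i. qvar n (\<sigma> (\<tau> j))) :: 'k ratfun)"
  proof (subst perm_act_prod[OF n \<sigma>])
    show "1 - (\<Prod>j=1..i. qvar n (\<tau> j)) \<in> (Kq n :: 'k ratfun set)" if "i \<in> {1..n-1}" for i
      using Kq le(2)[OF that] by (intro Kq_diff Kq_1)
    show "(\<Prod>i=1..n-1. perm_act n \<sigma> (1 - (\<Prod>j=1..i. qvar n (\<tau> j)))) =
      (\<Prod>i=1..n-1. 1 - (\<Prod>j=1..i. qvar n (\<sigma> (\<tau> j))) :: 'k ratfun)"
      by (rule prod.cong[OF refl], drule le(2)) (simp only: perm_act_diff[OF n \<sigma> Kq_1 Kq] perm_act_1[OF n \<sigma>] prefix)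
  qed
  moreover have "(\<Prod>j\<in>descents n \<tau>. \<Prod>i=1..j. qvar n (\<tau> i)) \<in> (Kq n :: 'k ratfun set)"
    by (rule Kq_prod, rule Kq, rule le(1))
  moreover have "(\<Prod>i=1..n-1. 1 - (\<Prod>j=1..i. qvar n (\<tau> j))) \<in> (Kq n :: 'k ratfun set)"
    by (rule Kq_prod, rule Kq_diff[OF Kq_1], rule Kq, rule le(2))
  ultimately show ?thesis
    unfolding cyclic_weight_word_of[OF n] by (simp only: perm_act_divide[OF n \<sigma>])
qed

text \<open>The left side is the coefficient of \<pi> in the twisted square, since
  \<open>\<sigma> \<circ> \<tau> = \<pi>\<close> means
  \<open>\<tau> = inv \<sigma> \<circ> \<pi>\<close>. For these \<tau> all transformed denominators
  equal \<open>d\<close>, which \<open>sum_cyclic_weight_descents\<close> cancels.\<close>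

lemma sum_cyclic_weight_perm_act:
  assumes n: "n \<ge> 1" and \<pi>: "\<pi> permutes {1..n}"
  shows "(\<Sum>\<sigma> | \<sigma> permutes {1..n}. cyclic_weight (qvar n) (word_of n \<sigma>) *
      perm_act n \<sigma> (cyclic_weight (qvar n) (word_of n (inv \<sigma> \<circ> \<pi>)))) =
    (cyclic_weight (qvar n) (word_of n \<pi>) :: 'k::field ratfun)"
proof -
  define y :: "nat \<Rightarrow> 'k ratfun" where "y j = (\<Prod>i=1..j. qvar n (\<pi> i))" for j
  define d where "d = (\<Prod>j\<in>{1..<n}. 1 - y j)"
  \<comment> \<open>\<open>y j\<close> is the product over the image of \<open>{1..j}\<close> under
    \<pi>, a nonempty proper subset of \<open>{1..n}\<close>.\<close>
  have "y j \<noteq> 1" if "j \<in> {1..<n}" for j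
  proof -
    have "y j = (\<Prod>i\<in>\<pi> ` {1..j}. qvar n i)"
      using permutes_inj_on[OF \<pi>] by (simp add: y_def prod.reindex)
    moreover have "\<pi> ` {1..j} \<subset> \<pi> ` {1..n}"
      using that by (intro image_strict_mono permutes_inj_on[OF \<pi>]) auto
    ultimately show ?thesis
      using prod_qvar_neq_1[OF n, of "\<pi> ` {1..j}"] that unfolding permutes_image[OF \<pi>] by auto
  qed
  then have d: "d \<noteq> 0" by (auto simp: d_def)
  have n1: "{1..n-1} = {1..<n}" using n by auto
  have "perm_act n \<sigma> (cyclic_weight (qvar n) (word_of n (inv \<sigma> \<circ> \<pi>))) =
      (\<Prod>j\<in>descents n (inv \<sigma> \<circ> \<pi>). y j) / d" if \<sigma>: "\<sigma> permutes {1..n}" for \<sigma>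
    using perm_act_cyclic_weight[OF n \<sigma> permutes_compose[OF \<pi> permutes_inv[OF \<sigma>]], where 'k = 'k]
    unfolding n1 by (simp add: permutes_inverses(1)[OF \<sigma>] y_def d_def)
  then have "(\<Sum>\<sigma> | \<sigma> permutes {1..n}. cyclic_weight (qvar n) (word_of n \<sigma>) *
      perm_act n \<sigma> (cyclic_weight (qvar n) (word_of n (inv \<sigma> \<circ> \<pi>)))) =
    (\<Sum>\<sigma> | \<sigma> permutes {1..n}. cyclic_weight (qvar n) (word_of n \<sigma>) * (\<Prod>j\<in>descents n (inv \<sigma> \<circ> \<pi>). y j)) / d"
    by (simp add: sum_divide_distrib)
  also have "\<dots> = cyclic_weight (qvar n) (word_of n \<pi>)"
    using d sum_cyclic_weight_descents[OF \<pi> prod_qvar[OF n] prod_qvar_neq_1[OF n], of y]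
    by (simp add: d_def)
  finally show ?thesis .
qed

theorem theorem1p8:
  fixes n :: nat
  assumes "n \<ge> 1"
  shows "(e_elem n :: (nat \<Rightarrow> nat) \<Rightarrow>\<^sub>0 ('k::field_char_0) ratfun) \<in> KqS n \<and>
    twisted_prod n (e_elem n) (e_elem n) = (e_elem n :: (nat \<Rightarrow> nat) \<Rightarrow>\<^sub>0 'k ratfun)"
proof
  let ?e = "e_elem n :: (nat \<Rightarrow> nat) \<Rightarrow>\<^sub>0 'k ratfun"
  let ?c = "\<lambda>\<sigma>. cyclic_weight (qvar n) (word_of n \<sigma>) :: 'k ratfun"
  let ?S = "{\<sigma>. \<sigma> permutes {1..n}}"
  note lookup = lookup_e_elem[OF assms, where 'a = 'k]
  have fin: "finite ?S" by (simp add: finite_permutations)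
  have keys: "Poly_Mapping.keys ?e \<subseteq> ?S"
    by (auto simp: in_keys_iff lookup split: if_splits)
  show "?e \<in> KqS n"
    using keys by (auto simp: KqS_def lookup cyclic_weight_in_Kq[OF assms])
  let ?t = "\<lambda>\<sigma> \<tau>. Poly_Mapping.single (\<sigma> \<circ> \<tau>)
    (Poly_Mapping.lookup ?e \<sigma> * perm_act n \<sigma> (Poly_Mapping.lookup ?e \<tau>))"
  \<comment> \<open>The sums over keys are extended to all permutations; for the right factor this
    uses that the action maps 0 to 0.\<close>
  have "twisted_prod n ?e ?e = (\<Sum>\<sigma>\<in>Poly_Mapping.keys ?e. \<Sum>\<tau>\<in>?S. ?t \<sigma> \<tau>)"
    unfolding twisted_prod_def using keys
    by (intro sum.cong refl sum.mono_neutral_left fin)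
      (auto simp: in_keys_iff perm_act_0[OF assms])
  also have "\<dots> = (\<Sum>\<sigma>\<in>?S. \<Sum>\<tau>\<in>?S. ?t \<sigma> \<tau>)"
    by (rule sum.mono_neutral_left[OF fin keys]) (auto simp: in_keys_iff)
  \<comment> \<open>For fixed \<sigma>, the substitution
    \<open>\<tau> = inv \<sigma> \<circ> \<pi>\<close> indexes the terms by their basis element
    \<pi>.\<close>
  also have "\<dots> = (\<Sum>\<sigma>\<in>?S. \<Sum>\<pi>\<in>?S. ?t \<sigma> (inv \<sigma> \<circ> \<pi>))"
  proof (rule sum.cong[OF refl])
    fix \<sigma> assume "\<sigma> \<in> ?S"
    then show "(\<Sum>\<tau>\<in>?S. ?t \<sigma> \<tau>) = (\<Sum>\<pi>\<in>?S. ?t \<sigma> (inv \<sigma> \<circ> \<pi>))"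
      by (intro sum.reindex_bij_witness[where i = "\<lambda>\<pi>. inv \<sigma> \<circ> \<pi>" and j = "\<lambda>\<tau>. \<sigma> \<circ> \<tau>"])
        (auto simp: o_assoc permutes_inv_o intro: permutes_compose permutes_inv)
  qed
  also have "\<dots> = (\<Sum>\<sigma>\<in>?S. \<Sum>\<pi>\<in>?S. Poly_Mapping.single \<pi> (?c \<sigma> * perm_act n \<sigma> (?c (inv \<sigma> \<circ> \<pi>))))"
  proof (intro sum.cong refl)
    fix \<sigma> \<pi> assume "\<sigma> \<in> ?S" "\<pi> \<in> ?S"
    then show "?t \<sigma> (inv \<sigma> \<circ> \<pi>) = Poly_Mapping.single \<pi> (?c \<sigma> * perm_act n \<sigma> (?c (inv \<sigma> \<circ> \<pi>)))"
      by (simp add: lookup o_assoc permutes_inv_o permutes_compose permutes_inv)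
  qed
  also have "\<dots> = (\<Sum>\<pi>\<in>?S. \<Sum>\<sigma>\<in>?S. Poly_Mapping.single \<pi> (?c \<sigma> * perm_act n \<sigma> (?c (inv \<sigma> \<circ> \<pi>))))"
    by (rule sum.swap)
  also have "\<dots> = (\<Sum>\<pi>\<in>?S. Poly_Mapping.single \<pi> (\<Sum>\<sigma>\<in>?S. ?c \<sigma> * perm_act n \<sigma> (?c (inv \<sigma> \<circ> \<pi>))))"
    by (intro sum.cong refl poly_mapping_eqI) (simp add: lookup_sum lookup_single when_def)
  also have "\<dots> = ?e"
    unfolding e_elem_eq[OF assms]
    by (intro sum.cong refl arg_cong[where f = "Poly_Mapping.single _"] sum_cyclic_weight_perm_act[OF assms]) simp
  finally show "twisted_prod n ?e ?e = ?e" .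
qed

end
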